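(* Let $\Psi=(E,\Delta)$ be a shifted ordered simplicial complex. Then $\Psi$ belongs to each of the classes QI, QE and QC.
   Context: An ordered simplicial complex is a pair $\Psi=(E,\Delta)$ with $E$ a finite totally ordered set and $\Delta\subseteq 2^E$ a simplicial complex (closed under taking subsets, $\emptyset\in\Delta$). Elements of $\Delta$ are independent sets; inclusion-maximal ones are bases; inclusion-minimal subsets of $E$ not in $\Delta$ are circuits. $\Psi$ is pure if all bases have the same cardinality. The lexicographic order on subsets of $E$ is the dictionary order on increasingly sorted lists. For an independent set $I$, the contraction of $I$ is $(E\setminus I,\{J\in\Delta: \ J\cap I=\emptyset,\ J\cup I\in\Delta\})$ restricted to subsets of $E\setminus I$, and $B_{I,0}$ denotes its lexicographically smallest basis. Shifted: whenever $B$ is a basis and $i<j$ in $E$ satisfy $i\notin B$, $j\in B$, the set $(B\setminus\{j\})\cup\{i\}$ is also a basis (such a complex is pure). QI: $\Psi$ is pure and for all independent $I_1,I_2$ with $|I_1|>|I_2|$, if $I_1\setminus I\subseteq B_{I,0}$ for some $I\subseteq I_1\cap I_2$, then there is $e\in I_1\setminus I_2$ with $I_2\cup\{e\}\in\Delta$. QE: $\Psi$ is pure and for all bases $B_1,B_2$ and $b_1\in B_1\setminus B_2$ with $b_1>\max(B_2\setminus B_1)$, there is $b_2\in B_2\setminus B_1$ with $(B_1\setminus\{b_1\})\cup\{b_2\}\in\Delta$. QC: if $C_1\neq C_2$ are circuits and $c\in C_1\cap C_2$ satisfies $c<\max (C_1\triangle C_2)$ (symmetric difference), then there is a circuit $C_3\subseteq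 (C_1\cup C_2)\setminus\{c\}$. *)

theory Defs
  imports Main
begin

text \<open>The total order on the finite ground set \<open>E\<close> is the one induced by the ambient type of class
  \<open>linorder\<close>.\<close>

definition ordered_simplicial_complex :: "'a::linorder set \<Rightarrow> 'a set set \<Rightarrow> bool" where
  "ordered_simplicial_complex E \<Delta> \<longleftrightarrow>
     finite E \<and> \<Delta> \<subseteq> Pow E \<and> {} \<in> \<Delta> \<and> (\<forall>I\<in>\<Delta>. \<forall>J. J \<subseteq> I \<longrightarrow> J \<in> \<Delta>)"

definition basis :: "'a set set \<Rightarrow> 'a set \<Rightarrow> bool" where
  "basis \<Delta> B \<longleftrightarrow> B \<in> \<Delta> \<and> (\<forall>I\<in>\<Delta>. B \<subseteq> I \<longrightarrow> I = B)"

definition circuit :: "'a set \<Rightarrow> 'a set set \<Rightarrow> 'a set \<Rightarrow> bool" where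
  "circuit E \<Delta> C \<longleftrightarrow> C \<subseteq> E \<and> C \<notin> \<Delta> \<and> (\<forall>D. D \<subset> C \<longrightarrow> D \<in> \<Delta>)"

definition pure_complex :: "'a set set \<Rightarrow> bool" where
  "pure_complex \<Delta> \<longleftrightarrow> (\<forall>B B'. basis \<Delta> B \<longrightarrow> basis \<Delta> B' \<longrightarrow> card B = card B')"

definition lex_less :: "'a::linorder set \<Rightarrow> 'a set \<Rightarrow> bool" where
  "lex_less A B \<longleftrightarrow>
     (sorted_list_of_set A, sorted_list_of_set B) \<in> lexord {(x, y). x < y}"

text \<open>The ground set of the contraction of \<open>I\<close>, namely \<open>E - I\<close>, carries the induced order; only the
  set of faces is needed to speak about its bases.\<close>

definition contraction :: "'a set set \<Rightarrow> 'a set \<Rightarrow> 'a set set" where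
  "contraction \<Delta> I = {J \<in> \<Delta>. J \<inter> I = {} \<and> J \<union> I \<in> \<Delta>}"

definition lex_min_basis :: "'a::linorder set set \<Rightarrow> 'a set" where
  "lex_min_basis \<Delta> = (THE B. basis \<Delta> B \<and> (\<forall>B'. basis \<Delta> B' \<and> B' \<noteq> B \<longrightarrow> lex_less B B'))"

text \<open>\<open>B_zero \<Delta> I\<close> is the set written \<open>B\<close> with index \<open>I,0\<close>.\<close>

definition B_zero :: "'a::linorder set set \<Rightarrow> 'a set \<Rightarrow> 'a set" where
  "B_zero \<Delta> I = lex_min_basis (contraction \<Delta> I)"

definition shifted :: "'a::linorder set \<Rightarrow> 'a set set \<Rightarrow> bool" where
  "shifted E \<Delta> \<longleftrightarrow>
     (\<forall>B. \<forall>i\<in>E. \<forall>j\<in>E. basis \<Delta> B \<and> i < j \<and> i \<notin> B \<and> j \<in> B \<longrightarrow> basis \<Delta> ((B - {j}) \<union> {i}))"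

definition QI :: "'a::linorder set \<Rightarrow> 'a set set \<Rightarrow> bool" where
  "QI E \<Delta> \<longleftrightarrow> ordered_simplicial_complex E \<Delta> \<and> pure_complex \<Delta> \<and>
     (\<forall>I1\<in>\<Delta>. \<forall>I2\<in>\<Delta>. card I1 > card I2 \<and> (\<exists>I. I \<subseteq> I1 \<inter> I2 \<and> I1 - I \<subseteq> B_zero \<Delta> I) \<longrightarrow>
        (\<exists>e\<in>I1 - I2. I2 \<union> {e} \<in> \<Delta>))"

text \<open>In \<open>QE\<close> and \<open>QC\<close> the maximum is taken over a finite nonempty set: purity makes
  \<open>B2 - B1\<close> nonempty as soon as \<open>B1 - B2\<close> is.\<close>

definition QE :: "'a::linorder set \<Rightarrow> 'a set set \<Rightarrow> bool" where
  "QE E \<Delta> \<longleftrightarrow> ordered_simplicial_complex E \<Delta> \<and> pure_complex \<Delta> \<and>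
     (\<forall>B1 B2. basis \<Delta> B1 \<and> basis \<Delta> B2 \<longrightarrow>
        (\<forall>b1\<in>B1 - B2. b1 > Max (B2 - B1) \<longrightarrow>
           (\<exists>b2\<in>B2 - B1. (B1 - {b1}) \<union> {b2} \<in> \<Delta>)))"

definition QC :: "'a::linorder set \<Rightarrow> 'a set set \<Rightarrow> bool" where
  "QC E \<Delta> \<longleftrightarrow> ordered_simplicial_complex E \<Delta> \<and>
     (\<forall>C1 C2. circuit E \<Delta> C1 \<and> circuit E \<Delta> C2 \<and> C1 \<noteq> C2 \<longrightarrow>
        (\<forall>c\<in>C1 \<inter> C2. c < Max ((C1 - C2) \<union> (C2 - C1)) \<longrightarrow>
           (\<exists>C3. circuit E \<Delta> C3 \<and> C3 \<subseteq> (C1 \<union> C2) - {c})))"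

lemma lex_less_total:
  assumes "finite A" "finite B" "A \<noteq> B"
  shows "lex_less A B \<or> lex_less B A"
proof -
  have "sorted_list_of_set A \<noteq> sorted_list_of_set B"
    using assms by (metis sorted_list_of_set.set_sorted_key_list_of_set)
  then show ?thesis
    unfolding lex_less_def
    using lexord_linear[of "{(x, y). x < y}" "sorted_list_of_set A" "sorted_list_of_set B"]
    by (simp add: not_less_iff_gr_or_eq) (metis linorder_less_linear)
qed

lemma lex_less_trans: "lex_less A B \<Longrightarrow> lex_less B C \<Longrightarrow> lex_less A C"
  unfolding lex_less_def
  by (rule lexord_trans) (auto simp: trans_def)

lemma lex_less_irrefl: "\<not> lex_less A A"
  unfolding lex_less_def by (rule lexord_irreflexive) auto

lemma ordered_simplicial_complex_contraction:
  assumes "ordered_simplicial_complex E \<Delta>" "I \<in> \<Delta>"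
  shows "ordered_simplicial_complex (E - I) (contraction \<Delta> I)"
proof -
  have "J \<union> I \<in> \<Delta>" if "K \<union> I \<in> \<Delta>" "J \<subseteq> K" for J K
  proof -
    have "J \<union> I \<subseteq> K \<union> I" using that(2) by blast
    then show ?thesis using assms(1) that(1) unfolding ordered_simplicial_complex_def by blast
  qed
  then show ?thesis
    using assms unfolding ordered_simplicial_complex_def contraction_def by auto
qed

lemma ex1_lex_min_basis:
  assumes "ordered_simplicial_complex E \<Delta>"
  shows "\<exists>!B. basis \<Delta> B \<and> (\<forall>B'. basis \<Delta> B' \<and> B' \<noteq> B \<longrightarrow> lex_less B B')"
proof (rule ex_ex1I)
  have fin: "finite \<Delta>" and finB: "\<And>B. B \<in> \<Delta> \<Longrightarrow> finite B" and ne: "\<Delta> \<noteq> {}"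
    using assms unfolding ordered_simplicial_complex_def
    by (auto intro: finite_subset)
  obtain B0 where "basis \<Delta> B0"
    using finite_has_maximal[OF fin ne] unfolding basis_def by metis
  then have ne': "{B. basis \<Delta> B} \<noteq> {}" by auto
  have fin': "finite {B. basis \<Delta> B}"
    by (rule finite_subset[OF _ fin]) (auto simp: basis_def)
  have "\<exists>B\<in>S. \<forall>B'\<in>S. B' \<noteq> B \<longrightarrow> lex_less B B'"
    if "finite S" "S \<noteq> {}" "\<forall>B\<in>S. finite B" for S :: "'a set set"
    using that
  proof (induction S rule: finite_ne_induct)
    case (singleton x)
    then show ?case by simp
  next
    case (insert x F)
    then obtain B where B: "B \<in> F" "\<forall>B'\<in>F. B' \<noteq> B \<longrightarrow> lex_less B B'" by auto
    have "lex_less x B \<or> lex_less B x"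
      using insert B by (intro lex_less_total) auto
    then show ?case using B by (auto dest: lex_less_trans)
  qed
  from this[OF fin' ne'] finB
  show "\<exists>B. basis \<Delta> B \<and> (\<forall>B'. basis \<Delta> B' \<and> B' \<noteq> B \<longrightarrow> lex_less B B')"
    by (auto simp: basis_def)
next
  fix A B
  assume "basis \<Delta> A \<and> (\<forall>B'. basis \<Delta> B' \<and> B' \<noteq> A \<longrightarrow> lex_less A B')"
    and "basis \<Delta> B \<and> (\<forall>B'. basis \<Delta> B' \<and> B' \<noteq> B \<longrightarrow> lex_less B B')"
  then show "A = B" using lex_less_trans lex_less_irrefl by blast
qed

end

theory Submission
  imports Defs
begin

text \<open>The exchange property defining shiftedness passes from bases to all faces. This gives \<open>QE\<close> at
  once. For \<open>QC\<close>, let \<open>m\<close> be the maximum of \<open>C1 \<triangle> C2\<close>, say \<open>m \<in> C1\<close>: if \<open>(C1 \<union> C2) - {c}\<close> were a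
  face, exchanging \<open>m\<close> for \<open>c\<close> would give a face containing \<open>C2\<close>. For \<open>QI\<close>, the basis \<open>Z = B_zero \<Delta> I\<close>
  is an initial segment of \<open>E - I\<close>. Extend \<open>I2\<close> to a basis \<open>B\<close>. If no element of \<open>I1 - I2\<close> can be
  added to \<open>I2\<close>, then \<open>B\<close> avoids \<open>I1 - I2\<close> and every element of \<open>B - I2\<close> is smaller than those of
  \<open>I1 - I2\<close>, hence lies in \<open>Z\<close>. Thus \<open>Z\<close> contains the disjoint sets \<open>I1 - I\<close> and \<open>B - I2\<close>, which
  together have more than \<open>card B - card I = card Z\<close> elements.\<close>

section \<open>Lexicographic order and exchange\<close>

lemma sorted_list_of_set_Un:
  fixes A B :: "'a::linorder set"
  assumes "finite A" "finite B" "\<And>x y. x \<in> A \<Longrightarrow> y \<in> B \<Longrightarrow> x < y"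
  shows "sorted_list_of_set (A \<union> B) = sorted_list_of_set A @ sorted_list_of_set B"
proof (rule sorted_distinct_set_unique)
  show "sorted (sorted_list_of_set A @ sorted_list_of_set B)"
    using assms by (auto simp: sorted_append dest: less_imp_le)
  show "distinct (sorted_list_of_set A @ sorted_list_of_set B)"
    using assms by auto
qed (use assms in auto)

text \<open>Both sorted lists begin with the elements of \<open>B\<close> below \<open>i\<close>.
  The next entry is \<open>i\<close> on the left, but some \<open>y > i\<close> on the right, where
  \<open>?U\<close> is nonempty because it contains \<open>j\<close>.\<close>

lemma lex_less_exchange:
  fixes i j :: "'a::linorder"
  assumes "finite B" "i < j" "i \<notin> B" "j \<in> B"
  shows "lex_less ((B - {j}) \<union> {i}) B"
proof -
  let ?L = "{x \<in> B. x < i}" and ?U = "{x \<in> B. i < x}"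
  have "sorted_list_of_set (?L \<union> ?U) = sorted_list_of_set ?L @ sorted_list_of_set ?U"
    using assms by (intro sorted_list_of_set_Un) auto
  moreover have neq: "x < i \<or> i < x" if "x \<in> B" for x
    using that \<open>i \<notin> B\<close> by (metis linorder_cases)
  then have "?L \<union> ?U = B" by blast
  ultimately have B: "sorted_list_of_set B = sorted_list_of_set ?L @ sorted_list_of_set ?U" by simp
  have "sorted_list_of_set (?L \<union> ({i} \<union> (?U - {j})))
      = sorted_list_of_set ?L @ sorted_list_of_set ({i} \<union> (?U - {j}))"
    using assms by (intro sorted_list_of_set_Un) auto
  moreover have "sorted_list_of_set ({i} \<union> (?U - {j})) = [i] @ sorted_list_of_set (?U - {j})"
    using assms by (subst sorted_list_of_set_Un) auto
  moreover have "?L \<union> ({i} \<union> (?U - {j})) = (B - {j}) \<union> {i}" using neq assms(2) by auto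
  ultimately have B': "sorted_list_of_set ((B - {j}) \<union> {i})
      = sorted_list_of_set ?L @ i # sorted_list_of_set (?U - {j})" by simp
  have "set (sorted_list_of_set ?U) = ?U" using assms by simp
  then obtain y ys where y: "sorted_list_of_set ?U = y # ys" "i < y"
    using assms by (cases "sorted_list_of_set ?U") auto
  show ?thesis
    unfolding lex_less_def B B' y(1) using y(2) by (intro lexord_append_leftI) simp
qed

section \<open>Faces, circuits and bases of a shifted complex\<close>

lemma face_subset_basis:
  assumes "ordered_simplicial_complex E \<Delta>" "I \<in> \<Delta>"
  obtains B where "basis \<Delta> B" "I \<subseteq> B"
proof -
  have "finite \<Delta>"
    using assms unfolding ordered_simplicial_complex_def by (auto intro: finite_subset)
  from finite_has_maximal2[OF this assms(2)] show thesis
    using that unfolding basis_def by metis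
qed

text \<open>Reduces circuit elimination to showing that a subset of \<open>E\<close> is not a face:
  an inclusion-minimal non-face inside it is a circuit.\<close>

lemma nonface_contains_circuit:
  assumes "ordered_simplicial_complex E \<Delta>" "U \<subseteq> E" "U \<notin> \<Delta>"
  obtains C where "circuit E \<Delta> C" "C \<subseteq> U"
proof -
  have "finite (Pow U - \<Delta>)"
    using assms unfolding ordered_simplicial_complex_def by (auto intro: finite_subset)
  moreover have "U \<in> Pow U - \<Delta>" using assms by simp
  ultimately obtain C where "C \<in> Pow U - \<Delta>" "\<forall>D\<in>Pow U - \<Delta>. D \<subseteq> C \<longrightarrow> C = D"
    using finite_has_minimal2[of "Pow U - \<Delta>" U] by blast
  then have "circuit E \<Delta> C" "C \<subseteq> U"
    using assms(2) unfolding circuit_def by auto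
  then show thesis by (rule that)
qed

text \<open>Extend \<open>I\<close> to a basis \<open>B\<close>. If \<open>i\<close> is already in
  \<open>B\<close>, the new set lies inside \<open>B\<close>; otherwise it lies inside the basis
  obtained from \<open>B\<close> by the exchange.\<close>

lemma shifted_face_exchange:
  assumes osc: "ordered_simplicial_complex E \<Delta>" and sh: "shifted E \<Delta>"
    and "I \<in> \<Delta>" "i \<in> E" "i < j" "j \<in> I"
  shows "(I - {j}) \<union> {i} \<in> \<Delta>"
proof -
  obtain B where B: "basis \<Delta> B" "I \<subseteq> B"
    using face_subset_basis[OF osc \<open>I \<in> \<Delta>\<close>] .
  have j: "j \<in> E" using osc assms unfolding ordered_simplicial_complex_def by blast
  have "\<exists>F\<in>\<Delta>. (I - {j}) \<union> {i} \<subseteq> F"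
  proof (cases "i \<in> B")
    case True
    then have "(I - {j}) \<union> {i} \<subseteq> B" using B(2) by blast
    then show ?thesis using B(1) unfolding basis_def by blast
  next
    case False
    then have "basis \<Delta> ((B - {j}) \<union> {i})"
      using sh B assms j unfolding shifted_def by blast
    then have "(B - {j}) \<union> {i} \<in> \<Delta>" unfolding basis_def by simp
    moreover have "(I - {j}) \<union> {i} \<subseteq> (B - {j}) \<union> {i}" using B(2) by blast
    ultimately show ?thesis by (rule bexI[rotated])
  qed
  then show ?thesis using osc unfolding ordered_simplicial_complex_def by blast
qed

text \<open>Prepares the proof of purity, so the cardinality has to be carried along. A basis of
  minimal total rank among those of the given size is an initial segment of \<open>E\<close>,
  because any possible exchange would lower the total.\<close>

lemma shifted_initial_basis:
  assumes osc: "ordered_simplicial_complex E \<Delta>" and sh: "shifted E \<Delta>" and B: "basis \<Delta> B"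
  obtains S where "basis \<Delta> S" "card S = card B" "\<And>i j. i \<in> E \<Longrightarrow> j \<in> S \<Longrightarrow> i < j \<Longrightarrow> i \<in> S"
proof -
  \<comment> \<open>Elements of \<open>E\<close> are only ordered; their positions serve as summable
    weights.\<close>
  define rank where "rank = (\<lambda>x. card {y \<in> E. y < x})"
  let ?P = "\<lambda>S. basis \<Delta> S \<and> card S = card B"
  have "\<exists>S. ?P S \<and> (\<forall>T. ?P T \<longrightarrow> sum rank S \<le> sum rank T)"
    using ex_has_least_nat[of ?P B "sum rank"] B by blast
  then obtain S where S: "?P S" and min: "\<And>T. ?P T \<Longrightarrow> sum rank S \<le> sum rank T"
    by blast
  have finE: "finite E" and SE: "S \<subseteq> E"
    using osc S unfolding ordered_simplicial_complex_def basis_def by auto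
  then have finS: "finite S" by (auto intro: finite_subset)
  have "i \<in> S" if "i \<in> E" "j \<in> S" "i < j" for i j
  proof (rule ccontr)
    assume i: "i \<notin> S"
    then have "basis \<Delta> ((S - {j}) \<union> {i})"
      using sh S SE that unfolding shifted_def by blast
    moreover have "card ((S - {j}) \<union> {i}) = card B"
      using S finS i that card_Suc_Diff1[of S j] by simp
    ultimately have "sum rank S \<le> sum rank ((S - {j}) \<union> {i})" by (intro min) simp
    moreover have "sum rank ((S - {j}) \<union> {i}) = rank i + sum rank (S - {j})"
      using finS i by simp
    moreover have "sum rank S = rank j + sum rank (S - {j})"
      using finS that by (simp add: sum.remove)
    moreover have "rank i < rank j"
      unfolding rank_def using that finE by (intro psubset_card_mono) auto
    ultimately show False by simp
  qed
  with S show thesis using that by blast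
qed

text \<open>Each basis has the size of a basis that is an initial segment of \<open>E\<close>. Two
  initial segments are comparable by inclusion, so by maximality these two bases coincide.\<close>

lemma shifted_pure:
  assumes osc: "ordered_simplicial_complex E \<Delta>" and sh: "shifted E \<Delta>"
  shows "pure_complex \<Delta>"
  unfolding pure_complex_def
proof (intro allI impI)
  fix B B' assume "basis \<Delta> B" "basis \<Delta> B'"
  obtain S where S: "basis \<Delta> S" "card S = card B"
      "\<And>i j. i \<in> E \<Longrightarrow> j \<in> S \<Longrightarrow> i < j \<Longrightarrow> i \<in> S"
    using shifted_initial_basis[OF osc sh \<open>basis \<Delta> B\<close>] by blast
  obtain T where T: "basis \<Delta> T" "card T = card B'"
      "\<And>i j. i \<in> E \<Longrightarrow> j \<in> T \<Longrightarrow> i < j \<Longrightarrow> i \<in> T"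
    using shifted_initial_basis[OF osc sh \<open>basis \<Delta> B'\<close>] by blast
  have "S \<subseteq> E" "T \<subseteq> E"
    using osc S(1) T(1) unfolding ordered_simplicial_complex_def basis_def by auto
  have "S \<subseteq> T \<or> T \<subseteq> S"
  proof (rule ccontr)
    assume "\<not> (S \<subseteq> T \<or> T \<subseteq> S)"
    then obtain x y where xy: "x \<in> S" "x \<notin> T" "y \<in> T" "y \<notin> S" by blast
    then have "x \<in> E" "y \<in> E" using \<open>S \<subseteq> E\<close> \<open>T \<subseteq> E\<close> by auto
    with xy S(3)[of y x] T(3)[of x y] show False by (cases x y rule: linorder_cases) auto
  qed
  then have "S = T" using S(1) T(1) unfolding basis_def by blast
  with S T show "card B = card B'" by simp
qed

section \<open>Contractions and their smallest bases\<close>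

lemma basis_contraction_iff:
  assumes "ordered_simplicial_complex E \<Delta>"
  shows "basis (contraction \<Delta> I) Z \<longleftrightarrow> Z \<inter> I = {} \<and> basis \<Delta> (Z \<union> I)"
proof
  assume Z: "basis (contraction \<Delta> I) Z"
  \<comment> \<open>Removing \<open>I\<close> turns a face containing \<open>I\<close> into a face
    of the contraction and preserves inclusion, so maximality carries over.\<close>
  have "J = Z \<union> I" if J: "J \<in> \<Delta>" "Z \<union> I \<subseteq> J" for J
  proof -
    have "J - I \<in> \<Delta>" using assms J unfolding ordered_simplicial_complex_def by blast
    moreover have "(J - I) \<union> I = J" using J by blast
    ultimately have "J - I \<in> contraction \<Delta> I" using J unfolding contraction_def by auto
    moreover have "Z \<subseteq> J - I" using Z J unfolding basis_def contraction_def by auto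
    ultimately have "J - I = Z" using Z unfolding basis_def by blast
    then show ?thesis using J by blast
  qed
  then show "Z \<inter> I = {} \<and> basis \<Delta> (Z \<union> I)"
    using Z unfolding basis_def contraction_def by auto
next
  assume Z: "Z \<inter> I = {} \<and> basis \<Delta> (Z \<union> I)"
  then have ZI: "Z \<union> I \<in> \<Delta>" unfolding basis_def by simp
  then have "Z \<in> \<Delta>" using assms unfolding ordered_simplicial_complex_def by (meson Un_upper1)
  with Z ZI have "Z \<in> contraction \<Delta> I" unfolding contraction_def by simp
  moreover have "J = Z" if "J \<in> contraction \<Delta> I" "Z \<subseteq> J" for J
  proof -
    have J: "J \<union> I \<in> \<Delta>" "J \<inter> I = {}" using that unfolding contraction_def by auto
    moreover have "Z \<union> I \<subseteq> J \<union> I" using that by blast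
    ultimately have "J \<union> I = Z \<union> I" using Z unfolding basis_def by simp
    with J Z show ?thesis by blast
  qed
  ultimately show "basis (contraction \<Delta> I) Z" unfolding basis_def by blast
qed

lemma basis_B_zero:
  assumes "ordered_simplicial_complex E \<Delta>" "I \<in> \<Delta>"
  shows "basis (contraction \<Delta> I) (B_zero \<Delta> I)"
    and "\<And>B. basis (contraction \<Delta> I) B \<Longrightarrow> B \<noteq> B_zero \<Delta> I \<Longrightarrow> lex_less (B_zero \<Delta> I) B"
  using theI'[OF ex1_lex_min_basis[OF ordered_simplicial_complex_contraction[OF assms]]]
  unfolding B_zero_def lex_min_basis_def by simp_all

text \<open>If \<open>i\<close> were missing, exchanging \<open>j\<close> for \<open>i\<close> in
  the basis \<open>?Z \<union> I\<close> would leave \<open>I\<close> untouched, and so give a basis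
  of the contraction lexicographically smaller than \<open>?Z\<close>.\<close>

lemma shifted_B_zero_initial:
  assumes osc: "ordered_simplicial_complex E \<Delta>" and sh: "shifted E \<Delta>" and I: "I \<in> \<Delta>"
    and i: "i \<in> E - I" and j: "j \<in> B_zero \<Delta> I" and "i < j"
  shows "i \<in> B_zero \<Delta> I"
proof (rule ccontr)
  let ?Z = "B_zero \<Delta> I" and ?Z' = "(B_zero \<Delta> I - {j}) \<union> {i}"
  assume "i \<notin> ?Z"
  have Z: "?Z \<inter> I = {}" "basis \<Delta> (?Z \<union> I)"
    using basis_B_zero(1)[OF osc I] basis_contraction_iff[OF osc] by auto
  have finE: "finite E" and ZE: "?Z \<subseteq> E"
    using osc Z(2) unfolding ordered_simplicial_complex_def basis_def by auto
  have "basis \<Delta> ((?Z \<union> I) - {j} \<union> {i})"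
    using sh Z(2) i j ZE \<open>i < j\<close> \<open>i \<notin> ?Z\<close> unfolding shifted_def by blast
  moreover have "(?Z \<union> I) - {j} \<union> {i} = ?Z' \<union> I" using Z(1) j by blast
  ultimately have "basis (contraction \<Delta> I) ?Z'"
    using basis_contraction_iff[OF osc, of I ?Z'] Z(1) i by auto
  moreover have "?Z' \<noteq> ?Z" using \<open>i \<notin> ?Z\<close> by blast
  ultimately have "lex_less ?Z ?Z'" by (rule basis_B_zero(2)[OF osc I])
  moreover have "lex_less ?Z' ?Z"
    using finE ZE \<open>i \<notin> ?Z\<close> j \<open>i < j\<close> by (intro lex_less_exchange) (auto intro: finite_subset)
  ultimately show False using lex_less_trans lex_less_irrefl by blast
qed

section \<open>The three classes\<close>

lemma shifted_QI:
  assumes osc: "ordered_simplicial_complex E \<Delta>" and sh: "shifted E \<Delta>"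
  shows "QI E \<Delta>"
proof -
  have "\<exists>e\<in>I1 - I2. I2 \<union> {e} \<in> \<Delta>"
    if I1: "I1 \<in> \<Delta>" and I2: "I2 \<in> \<Delta>" and less: "card I2 < card I1"
      and I: "I \<subseteq> I1 \<inter> I2" and sub: "I1 - I \<subseteq> B_zero \<Delta> I" for I1 I2 I
  proof (rule ccontr)
    assume no: "\<not> (\<exists>e\<in>I1 - I2. I2 \<union> {e} \<in> \<Delta>)"
    let ?Z = "B_zero \<Delta> I"
    have finE: "finite E" and \<Delta>E: "\<And>A. A \<in> \<Delta> \<Longrightarrow> A \<subseteq> E"
      and down: "\<And>A B. A \<in> \<Delta> \<Longrightarrow> B \<subseteq> A \<Longrightarrow> B \<in> \<Delta>"
      using osc unfolding ordered_simplicial_complex_def by auto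
    have fin: "finite A" if "A \<in> \<Delta>" for A
      using finE \<Delta>E[OF that] by (rule finite_subset[rotated])
    have I\<Delta>: "I \<in> \<Delta>" using down I1 I by blast
    obtain B where B: "basis \<Delta> B" "I2 \<subseteq> B"
      using face_subset_basis[OF osc I2] .
    then have B\<Delta>: "B \<in> \<Delta>" unfolding basis_def by blast
    have Z: "?Z \<inter> I = {}" "basis \<Delta> (?Z \<union> I)"
      using basis_B_zero(1)[OF osc I\<Delta>] basis_contraction_iff[OF osc] by auto
    then have finZ: "finite ?Z" using fin unfolding basis_def by blast
    have "card (?Z \<union> I) = card B"
      using shifted_pure[OF osc sh] B(1) Z(2) unfolding pure_complex_def by blast
    then have cZ: "card ?Z + card I = card B"
      using card_Un_disjoint[OF finZ fin[OF I\<Delta>] Z(1)] by simp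
    \<comment> \<open>A common element could be added to \<open>I2\<close> without leaving
      \<open>B\<close>.\<close>
    have disj: "(I1 - I) \<inter> (B - I2) = {}"
    proof (rule ccontr)
      assume "(I1 - I) \<inter> (B - I2) \<noteq> {}"
      then obtain x where "x \<in> I1 - I2" "x \<in> B" by blast
      moreover from this have "I2 \<union> {x} \<in> \<Delta>" using B(2) by (intro down[OF B\<Delta>]) blast
      ultimately show False using no by blast
    qed
    \<comment> \<open>One such \<open>e\<close> suffices: it lies outside \<open>I\<close>, hence in
      \<open>?Z\<close>, and everything in \<open>E - I\<close> below it is then in
      \<open>?Z\<close> too.\<close>
    obtain e where e: "e \<in> I1 - I2"
      using less card_mono[OF fin[OF I2], of I1] by (metis DiffI not_le subsetI)
    have "B - I2 \<subseteq> ?Z"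
    proof
      fix b assume b: "b \<in> B - I2"
      \<comment> \<open>Otherwise exchanging \<open>b\<close> for \<open>e\<close> in the face
        \<open>I2 \<union> {b}\<close> would add \<open>e\<close> to \<open>I2\<close>.\<close>
      have "\<not> e < b"
      proof
        assume "e < b"
        moreover have "I2 \<union> {b} \<in> \<Delta>" using B(2) b by (intro down[OF B\<Delta>]) blast
        ultimately have "(I2 \<union> {b}) - {b} \<union> {e} \<in> \<Delta>"
          using shifted_face_exchange[OF osc sh] e \<Delta>E[OF I1] by blast
        then show False using no e b by auto
      qed
      moreover have "b \<noteq> e" using disj e b I by blast
      ultimately have "b < e" by simp
      then show "b \<in> ?Z"
        using shifted_B_zero_initial[OF osc sh I\<Delta>, of b e] b e I sub \<Delta>E[OF B\<Delta>] by blast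
    qed
    then have "card ((I1 - I) \<union> (B - I2)) \<le> card ?Z"
      using sub finZ by (intro card_mono) auto
    then have "card (I1 - I) + card (B - I2) \<le> card ?Z"
      using disj fin[OF I1] fin[OF B\<Delta>] by (subst (asm) card_Un_disjoint) auto
    \<comment> \<open>The inequalities recorded with the differences exclude truncated subtraction;
      the count then yields \<open>card I1 \<le> card I2\<close>.\<close>
    moreover have "card (I1 - I) = card I1 - card I" "card I \<le> card I1"
      using I fin[OF I1] fin[OF I\<Delta>] by (auto intro: card_Diff_subset card_mono)
    moreover have "card (B - I2) = card B - card I2" "card I2 \<le> card B"
      using B(2) fin[OF B\<Delta>] fin[OF I2] by (auto intro: card_Diff_subset card_mono)
    ultimately show False using cZ less by linarith
  qed
  then show ?thesis
    using osc shifted_pure[OF osc sh] unfolding QI_def by blast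
qed

lemma shifted_QE:
  assumes osc: "ordered_simplicial_complex E \<Delta>" and sh: "shifted E \<Delta>"
  shows "QE E \<Delta>"
proof -
  have "\<exists>b2\<in>B2 - B1. (B1 - {b1}) \<union> {b2} \<in> \<Delta>"
    if B: "basis \<Delta> B1" "basis \<Delta> B2" and b1: "b1 \<in> B1 - B2" "b1 > Max (B2 - B1)" for B1 B2 b1
  proof -
    have sub: "B1 \<in> \<Delta>" "B2 \<subseteq> E" and "finite E"
      using osc B unfolding ordered_simplicial_complex_def basis_def by auto
    then have "finite B2" by (auto intro: finite_subset)
    \<comment> \<open>By maximality of \<open>B2\<close>, an inclusion
      \<open>B2 \<subseteq> B1\<close> would be an equality and leave no room for \<open>b1\<close>.
      So the maximum is a genuine element of \<open>B2 - B1\<close>, and it can serve as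
      \<open>b2\<close>.\<close>
    have "B2 - B1 \<noteq> {}" using B b1 unfolding basis_def by blast
    then have "Max (B2 - B1) \<in> B2 - B1" using \<open>finite B2\<close> by (intro Max_in) auto
    then show ?thesis
      using shifted_face_exchange[OF osc sh sub(1)] sub(2) b1 by blast
  qed
  then show ?thesis
    using osc shifted_pure[OF osc sh] unfolding QE_def by blast
qed

text \<open>Stated for some \<open>m\<close> in \<open>C1 - C2\<close> above \<open>c\<close>, so
  that it applies with the circuits in either order, according to which of them contains the
  maximum.\<close>

lemma shifted_circuit_elimination:
  assumes osc: "ordered_simplicial_complex E \<Delta>" and sh: "shifted E \<Delta>"
    and "circuit E \<Delta> C1" "circuit E \<Delta> C2" "c \<in> C1 \<inter> C2" "m \<in> C1 - C2" "c < m"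
  shows "\<exists>C3. circuit E \<Delta> C3 \<and> C3 \<subseteq> (C1 \<union> C2) - {c}"
proof -
  let ?U = "(C1 \<union> C2) - {c}"
  have "?U \<notin> \<Delta>"
  proof
    assume "?U \<in> \<Delta>"
    then have "(?U - {m}) \<union> {c} \<in> \<Delta>"
      using assms by (intro shifted_face_exchange[OF osc sh]) (auto simp: circuit_def)
    moreover have "C2 \<subseteq> (?U - {m}) \<union> {c}" using assms by blast
    ultimately have "C2 \<in> \<Delta>" using osc unfolding ordered_simplicial_complex_def by blast
    then show False using assms unfolding circuit_def by blast
  qed
  moreover have "?U \<subseteq> E" using assms unfolding circuit_def by blast
  ultimately show ?thesis using nonface_contains_circuit[OF osc] by blast
qed

lemma shifted_QC:
  assumes osc: "ordered_simplicial_complex E \<Delta>" and sh: "shifted E \<Delta>"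
  shows "QC E \<Delta>"
proof -
  have "\<exists>C3. circuit E \<Delta> C3 \<and> C3 \<subseteq> (C1 \<union> C2) - {c}"
    if C: "circuit E \<Delta> C1" "circuit E \<Delta> C2" "C1 \<noteq> C2" and c: "c \<in> C1 \<inter> C2"
      and less: "c < Max ((C1 - C2) \<union> (C2 - C1))" for C1 C2 c
  proof -
    let ?m = "Max ((C1 - C2) \<union> (C2 - C1))"
    have "finite ((C1 - C2) \<union> (C2 - C1))"
      using osc C unfolding ordered_simplicial_complex_def circuit_def
      by (auto intro: finite_subset)
    moreover have "(C1 - C2) \<union> (C2 - C1) \<noteq> {}" using C(3) by blast
    ultimately have "?m \<in> (C1 - C2) \<union> (C2 - C1)" by (rule Max_in)
    then show ?thesis
      using shifted_circuit_elimination[OF osc sh C(1,2) c _ less]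
        shifted_circuit_elimination[OF osc sh C(2,1) _ _ less] c
      by (auto simp: Un_commute)
  qed
  then show ?thesis using osc unfolding QC_def by blast
qed

theorem theorem4p2:
  fixes E :: "'a::linorder set" and \<Delta> :: "'a set set"
  assumes "ordered_simplicial_complex E \<Delta>"
    and "shifted E \<Delta>"
  shows "QI E \<Delta> \<and> QE E \<Delta> \<and> QC E \<Delta>"
  using shifted_QI[OF assms] shifted_QE[OF assms] shifted_QC[OF assms] by blast

end
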